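(* For each positive integer $n$ we have $$\mathrm{Diag}\mathbb{P}(x)\sim \mathbb{P}_{n}^{T}(x)\qquad\text{as } x\rightarrow\infty.$$
   Context: $p_n$ denotes the $n$th prime number ($p_1=2$, $p_2=3$, ...). For positive integers $n,k$, define $p_n^{(k)}$ recursively by $p_n^{(1)}:=p_n$ and $p_n^{(k)}:=p_{p_n^{(k-1)}}$ for $k\ge 2$. Let $\mathbb{N}$ be the set of positive integers, and define the sets $\mathrm{Diag}\mathbb{P}:=\{p_k^{(k)} : k\in\mathbb{N}\}$ and $\mathbb{P}_n^T:=\{p_n^{(k)} : k\in\mathbb{N}\}$ for each $n\in\mathbb{N}$. For a set $A\subseteq\mathbb{N}$, its counting function is $A(x):=\#(A\cap[1,x])$; thus $\mathrm{Diag}\mathbb{P}(x)$ and $\mathbb{P}_n^T(x)$ are the counting functions of the sets above. $f\sim g$ means $\lim_{x\to\infty} f(x)/g(x)=1$. *)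

theory Defs
  imports
    Complex_Main
    "HOL-Computational_Algebra.Primes"
    "HOL-Library.Infinite_Set"
    "HOL-Library.Landau_Symbols"
begin

text \<open>The function \<open>enumerate\<close> counts from 0, whereas the primes are numbered from 1. The value
  at index 0 carries no meaning and is never used.\<close>

definition nth_prime :: "nat \<Rightarrow> nat" where
  "nth_prime n = enumerate {p. prime p} (n - 1)"

text \<open>\<open>iter_prime n k\<close> is \<open>p\<^sub>n\<^sup>(\<^sup>k\<^sup>)\<close>. The recursion is started at \<open>k = 0\<close> with the convention
  \<open>p\<^sub>n\<^sup>(\<^sup>0\<^sup>) = n\<close>; the lemmas below give the usual equations for \<open>k \<ge> 1\<close>.\<close>

primrec iter_prime :: "nat \<Rightarrow> nat \<Rightarrow> nat" where
  "iter_prime n 0 = n"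
| "iter_prime n (Suc k) = nth_prime (iter_prime n k)"

lemma iter_prime_1: "iter_prime n 1 = nth_prime n"
  by simp

lemma iter_prime_rec: "k \<ge> 2 \<Longrightarrow> iter_prime n k = nth_prime (iter_prime n (k - 1))"
  by (cases k) auto

definition DiagP :: "nat set" where
  "DiagP = {iter_prime k k |k. k \<ge> 1}"

definition PT :: "nat \<Rightarrow> nat set" where
  "PT n = {iter_prime n k |k. k \<ge> 1}"

definition counting_fun :: "nat set \<Rightarrow> real \<Rightarrow> real" where
  "counting_fun A x = real (card {a \<in> A. 1 \<le> a \<and> real a \<le> x})"

lemma nth_prime_1: "nth_prime 1 = 2"
proof -
  have "(LEAST p::nat. prime p) = 2"
    by (rule Least_equality) (auto intro: prime_ge_2_nat)
  then show ?thesis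
    by (simp add: nth_prime_def enumerate_0)
qed

lemma prime_nth_prime: "prime (nth_prime n)"
  using enumerate_in_set[OF primes_infinite] by (simp add: nth_prime_def)

text \<open>The relation \<open>\<sim>[at_top]\<close> of the library reads the quotient 0/0 as 1. By the next lemma this
  does not occur for large arguments when the right-hand side is the counting function
  of \<open>PT n\<close>.\<close>

lemma counting_fun_PT_pos:
  assumes "x \<ge> real (nth_prime n)"
  shows "counting_fun (PT n) x > 0"
proof -
  let ?S = "{a \<in> PT n. 1 \<le> a \<and> real a \<le> x}"
  have "?S \<subseteq> {..nat \<lfloor>x\<rfloor>}"
    by (auto simp: le_nat_floor)
  then have "finite ?S"
    by (rule finite_subset) simp
  moreover have "nth_prime n \<in> PT n"
    unfolding PT_def using iter_prime_1[of n, symmetric] by blast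
  then have "nth_prime n \<in> ?S"
    using assms prime_gt_0_nat[OF prime_nth_prime[of n]] by simp
  ultimately have "card ?S > 0"
    using card_gt_0_iff by blast
  then show ?thesis
    by (simp add: counting_fun_def)
qed

end

theory Submission
  imports Defs "HOL-Real_Asymp.Real_Asymp"
begin

text \<open>For \<open>k \<ge> n\<close> we have \<open>p\<^sub>n\<^sup>(\<^sup>k\<^sup>) \<le> p\<^sub>k\<^sup>(\<^sup>k\<^sup>)\<close>, so the diagonal counting function \<open>D\<close> is eventually at
  most the counting function \<open>T\<close> of the \<open>n\<close>-th row. Conversely, \<open>p\<^sub>m \<ge> 2m - 1\<close> makes \<open>p\<^sub>n\<^sup>(\<^sup>s\<^sup>)\<close> grow
  exponentially in \<open>s\<close>, so \<open>k \<le> p\<^sub>n\<^sup>(\<^sup>s\<^sup>)\<close> for some \<open>s = log\<^sub>2 k + O(1)\<close>, whence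
  \<open>p\<^sub>k\<^sup>(\<^sup>k\<^sup>) \<le> p\<^sub>n\<^sup>(\<^sup>k\<^sup>+\<^sup>s\<^sup>)\<close>. Thus \<open>D \<le> T \<le> D + O(log D)\<close>.\<close>

lemma nth_prime_mono: "m \<le> n \<Longrightarrow> nth_prime m \<le> nth_prime n"
  unfolding nth_prime_def by (simp add: enumerate_mono_le_iff primes_infinite)

text \<open>Every prime after the first is odd, so an odd lower bound can be raised by 2 at each
  step. Index \<open>m\<close> counts from 0 here.\<close>

lemma enumerate_primes_ge: "2 * m + 1 \<le> enumerate {p::nat. prime p} m"
proof (induction m)
  case 0
  show ?case
    using prime_gt_0_nat[OF prime_nth_prime[of 1]] by (simp add: nth_prime_def Suc_le_eq)
next
  case (Suc m)
  let ?p = "enumerate {p::nat. prime p}"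
  have less: "?p m < ?p (Suc m)"
    by (intro enumerate_step primes_infinite)
  have prime: "prime (?p k)" for k
    using prime_nth_prime[of "Suc k"] by (simp add: nth_prime_def)
  have "2 < ?p (Suc m)"
    using less prime_ge_2_nat[OF prime[of m]] by linarith
  then have "odd (?p (Suc m))"
    by (rule prime_odd_nat[OF prime])
  then obtain q where q: "?p (Suc m) = 2 * q + 1"
    by (rule oddE)
  then have "m < q"
    using less Suc.IH by linarith
  then show ?case
    by (simp add: q)
qed

text \<open>Keeping the 1 on the right avoids truncated subtraction.\<close>

lemma nth_prime_ge: "2 * m \<le> nth_prime m + 1"
  using enumerate_primes_ge[of "m - 1"] by (simp add: nth_prime_def)

lemma less_nth_prime: "m < nth_prime m"
  using nth_prime_ge[of m] prime_ge_2_nat[OF prime_nth_prime[of m]] by linarith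

lemma iter_prime_mono: "m \<le> n \<Longrightarrow> iter_prime m k \<le> iter_prime n k"
  by (induction k) (auto intro: nth_prime_mono)

lemma iter_prime_add: "iter_prime n (j + k) = iter_prime (iter_prime n j) k"
  by (induction k) auto

lemma strict_mono_iter_prime: "strict_mono (iter_prime n)"
  by (simp add: strict_mono_Suc_iff less_nth_prime)

lemma strict_mono_diag: "strict_mono (\<lambda>k. iter_prime k k)"
  unfolding strict_mono_Suc_iff
proof
  fix k
  have "iter_prime k k \<le> iter_prime (Suc k) k"
    by (rule iter_prime_mono) simp
  also have "\<dots> < iter_prime (Suc k) (Suc k)"
    by (simp add: less_nth_prime)
  finally show "iter_prime k k < iter_prime (Suc k) (Suc k)" .
qed

text \<open>Strictness sustains the doubling: from \<open>a \<ge> 2 ^ s + 1\<close> follows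
  \<open>nth_prime a \<ge> 2 * a - 1 \<ge> 2 ^ Suc s + 1\<close>. The bound is uniform in
  \<open>n\<close>.\<close>

lemma iter_prime_gt_power2: "2 ^ s < iter_prime n (Suc s)"
proof (induction s)
  case 0
  show ?case
    using prime_gt_1_nat[OF prime_nth_prime] by simp
next
  case (Suc s)
  then show ?case
    using nth_prime_ge[of "iter_prime n (Suc s)"] by simp
qed

text \<open>The indices \<open>k \<ge> 1\<close> with \<open>f k\<close> at most \<open>x\<close>
  form an initial segment \<open>{1..N}\<close>, so counts can be compared by comparing
  indices.\<close>

lemma counting_fun_strict_mono_image:
  fixes f :: "nat \<Rightarrow> nat"
  assumes "strict_mono f"
  obtains N where "counting_fun {f k |k. k \<ge> 1} x = real N"
    and "\<And>k. k \<ge> 1 \<Longrightarrow> k \<le> N \<longleftrightarrow> real (f k) \<le> x"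
proof -
  define K where "K = {k. k \<ge> 1 \<and> real (f k) \<le> x}"
  \<comment> \<open>This makes \<open>K\<close> finite and yields the condition
    \<open>1 \<le> a\<close> in the counting function.\<close>
  have ge: "k \<le> f k" for k
    using assms by (rule strict_mono_imp_increasing)
  have "K \<subseteq> {..nat \<lfloor>x\<rfloor>}"
  proof
    fix k
    assume "k \<in> K"
    then have "real k \<le> x"
      using ge[of k] by (simp add: K_def)
    then show "k \<in> {..nat \<lfloor>x\<rfloor>}"
      by (simp add: le_nat_floor)
  qed
  then have fin: "finite K"
    by (rule finite_subset) simp
  have "{a \<in> {f k |k. k \<ge> 1}. 1 \<le> a \<and> real a \<le> x} = f ` K"
  proof (intro set_eqI iffI)
    fix a
    assume "a \<in> f ` K"
    then obtain k where "a = f k" "k \<ge> 1" "real (f k) \<le> x"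
      by (auto simp: K_def)
    then show "a \<in> {a \<in> {f k |k. k \<ge> 1}. 1 \<le> a \<and> real a \<le> x}"
      using ge[of k] by auto
  qed (auto simp: K_def)
  moreover have "card (f ` K) = card K"
    using assms by (intro card_image) (auto simp: strict_mono_eq inj_on_def)
  ultimately have count: "counting_fun {f k |k. k \<ge> 1} x = real (card K)"
    unfolding counting_fun_def by simp
  have iff: "k \<le> card K \<longleftrightarrow> real (f k) \<le> x" if "k \<ge> 1" for k
  proof
    assume le: "real (f k) \<le> x"
    have "real (f j) \<le> x" if "j \<le> k" for j
      using strict_mono_less_eq[OF assms, of j k] le that by linarith
    then have "{1..k} \<subseteq> K"
      by (auto simp: K_def)
    from card_mono[OF fin this] show "k \<le> card K"
      by simp
  next
    assume le: "k \<le> card K"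
    show "real (f k) \<le> x"
    proof (rule ccontr)
      assume gt: "\<not> real (f k) \<le> x"
      have "j < k" if "real (f j) \<le> x" for j
        using strict_mono_less[OF assms, of j k] gt that by linarith
      then have "K \<subseteq> {1..<k}"
        by (auto simp: K_def)
      from card_mono[OF _ this] le that show False
        using \<open>k \<ge> 1\<close> by simp
    qed
  qed
  show thesis
    using that[OF count iff] .
qed

lemma counting_fun_DiagP_at_top: "filterlim (counting_fun DiagP) at_top at_top"
  unfolding filterlim_at_top
proof
  fix Z :: real
  \<comment> \<open>The maximum with 1 makes \<open>M\<close> an admissible index, as these start at
    1.\<close>
  define M where "M = max 1 (nat \<lceil>Z\<rceil>)"
  show "eventually (\<lambda>x. Z \<le> counting_fun DiagP x) at_top"
    using eventually_ge_at_top[of "real (iter_prime M M)"]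
  proof eventually_elim
    case (elim x)
    obtain N where N: "counting_fun DiagP x = real N"
      "\<And>k. k \<ge> 1 \<Longrightarrow> k \<le> N \<longleftrightarrow> real (iter_prime k k) \<le> x"
      unfolding DiagP_def using counting_fun_strict_mono_image[OF strict_mono_diag] by blast
    have "M \<le> N"
      using N(2)[of M] elim by (simp add: M_def)
    then show ?case
      unfolding N(1) M_def by linarith
  qed
qed

lemma counting_fun_DiagP_le_PT:
  assumes "n \<ge> 1" and "real n \<le> counting_fun DiagP x"
  shows "counting_fun DiagP x \<le> counting_fun (PT n) x"
proof -
  obtain D where D: "counting_fun DiagP x = real D"
    "\<And>k. k \<ge> 1 \<Longrightarrow> k \<le> D \<longleftrightarrow> real (iter_prime k k) \<le> x"
    unfolding DiagP_def using counting_fun_strict_mono_image[OF strict_mono_diag] by blast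
  obtain T where T: "counting_fun (PT n) x = real T"
    "\<And>k. k \<ge> 1 \<Longrightarrow> k \<le> T \<longleftrightarrow> real (iter_prime n k) \<le> x"
    unfolding PT_def using counting_fun_strict_mono_image[OF strict_mono_iter_prime] by blast
  \<comment> \<open>Once the diagonal index \<open>D\<close> has reached \<open>n\<close>,
    monotonicity in the base puts the row element of index \<open>D\<close> below the diagonal
    one.\<close>
  have "n \<le> D"
    using assms(2) D(1) by simp
  then have "real (iter_prime n D) \<le> x"
    using D(2)[of D] iter_prime_mono[of n D D] assms(1) by simp
  then show ?thesis
    using T(2)[of D] \<open>n \<le> D\<close> assms(1) by (simp add: D(1) T(1))
qed

lemma counting_fun_PT_le_DiagP:
  "counting_fun (PT n) x \<le> counting_fun DiagP x + log 2 (counting_fun DiagP x + 1) + 2"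
proof -
  obtain D where D: "counting_fun DiagP x = real D"
    "\<And>k. k \<ge> 1 \<Longrightarrow> k \<le> D \<longleftrightarrow> real (iter_prime k k) \<le> x"
    unfolding DiagP_def using counting_fun_strict_mono_image[OF strict_mono_diag] by blast
  obtain T where T: "counting_fun (PT n) x = real T"
    "\<And>k. k \<ge> 1 \<Longrightarrow> k \<le> T \<longleftrightarrow> real (iter_prime n k) \<le> x"
    unfolding PT_def using counting_fun_strict_mono_image[OF strict_mono_iter_prime] by blast
  \<comment> \<open>Chosen so that \<open>2 ^ s \<ge> D + 1\<close>: then \<open>Suc s\<close>
    iterations from \<open>n\<close> suffice to pass \<open>D + 1\<close>, the first diagonal index
    whose element exceeds \<open>x\<close>.\<close>
  define s where "s = nat \<lceil>log 2 (real D + 1)\<rceil>"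
  have log_nonneg: "0 \<le> log 2 (real D + 1)"
    by simp
  have "log 2 (real D + 1) \<le> real s"
    unfolding s_def by linarith
  then have "real (D + 1) \<le> real (2 ^ s)"
    by (simp add: log_le_iff powr_realpow)
  then have "D + 1 \<le> iter_prime n (Suc s)"
    using iter_prime_gt_power2[of s n] by linarith
  then have "iter_prime (D + 1) (D + 1) \<le> iter_prime n (Suc s + (D + 1))"
    unfolding iter_prime_add[of n "Suc s"] by (rule iter_prime_mono)
  moreover have "x < real (iter_prime (D + 1) (D + 1))"
    using D(2)[of "D + 1"] by simp
  ultimately have "x < real (iter_prime n (Suc s + (D + 1)))"
    by linarith
  then have "T < Suc s + (D + 1)"
    using T(2)[of "Suc s + (D + 1)"] by simp
  then have "real T \<le> real D + real s + 1"
    by linarith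
  moreover have "real s \<le> log 2 (real D + 1) + 1"
    unfolding s_def using log_nonneg by linarith
  ultimately show ?thesis
    by (simp add: D(1) T(1))
qed

theorem theorem3p2:
  fixes n :: nat
  assumes "n \<ge> 1"
  shows "counting_fun DiagP \<sim>[at_top] counting_fun (PT n)"
proof -
  let ?D = "counting_fun DiagP" and ?T = "counting_fun (PT n)"
  have ev: "eventually (\<lambda>x. real n \<le> ?D x) at_top"
    using counting_fun_DiagP_at_top by (simp add: filterlim_at_top)
  have lim: "((\<lambda>d. 1 + (log 2 (d + 1) + 2) / d) \<longlongrightarrow> 1) at_top"
    by real_asymp
  \<comment> \<open>The inverted quotient is used because both estimates bound \<open>?T\<close> in
    terms of \<open>?D\<close>; symmetry of the relation restores the order.\<close>
  have "((\<lambda>x. ?T x / ?D x) \<longlongrightarrow> 1) at_top"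
  proof (rule tendsto_sandwich)
    show "eventually (\<lambda>x. 1 \<le> ?T x / ?D x) at_top"
      using ev
    proof eventually_elim
      case (elim x)
      then show ?case
        using counting_fun_DiagP_le_PT[OF assms elim] assms by (simp add: field_simps)
    qed
    show "eventually (\<lambda>x. ?T x / ?D x \<le> 1 + (log 2 (?D x + 1) + 2) / ?D x) at_top"
      using ev
    proof eventually_elim
      case (elim x)
      then show ?case
        using counting_fun_PT_le_DiagP[of n x] assms by (simp add: field_simps)
    qed
    show "((\<lambda>x. 1 + (log 2 (?D x + 1) + 2) / ?D x) \<longlongrightarrow> 1) at_top"
      by (rule filterlim_compose[OF lim counting_fun_DiagP_at_top])
  qed simp
  then show ?thesis
    by (intro asymp_equiv_symI[OF asymp_equivI'])
qed

end
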